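(* Let $d\ge1$ and let $K\subset\mathbb{R}^d$ be an origin-symmetric convex body (compact convex set with non-empty interior). For every Borel set $E\subset\mathbb{R}^d$ of finite Lebesgue measure and of finite perimeter $$\lim_{\alpha\downarrow0}\alpha\,\mathrm{Per}_\alpha(E,K)=d\,|K|\,|E|.$$
   Context: $|\cdot|$ denotes Lebesgue measure of sets. $\|x\|_K=\inf\{\lambda>0:\lambda^{-1}x\in K\}$ is the norm with unit ball $K$. For $\alpha\in(0,1)$, $\mathrm{Per}_\alpha(E,K)=\int_E\int_{E^c}\|x-y\|_K^{-d-\alpha}\,\mathrm{d}x\,\mathrm{d}y$. $E$ has finite perimeter if $|D\mathbf{1}_E|(\mathbb{R}^d)<\infty$, where $D\mathbf{1}_E$ is the distributional gradient of $\mathbf 1_E$. *)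

theory Defs
  imports "HOL-Analysis.Analysis"
begin

definition origin_symmetric_convex_body :: "'a::euclidean_space set \<Rightarrow> bool" where
  "origin_symmetric_convex_body K \<longleftrightarrow>
     compact K \<and> convex K \<and> interior K \<noteq> {} \<and> (\<forall>x\<in>K. - x \<in> K)"

definition body_norm :: "'a::euclidean_space set \<Rightarrow> 'a \<Rightarrow> real" where
  "body_norm K x = Inf {l. 0 < l \<and> inverse l *\<^sub>R x \<in> K}"

(* Valued in [0, \<infinity>]. The kernel is never evaluated at the origin, since x \<in> E and y \<notin> E. *)
definition fractional_perimeter ::
    "real \<Rightarrow> 'a::euclidean_space set \<Rightarrow> 'a set \<Rightarrow> ennreal" where
  "fractional_perimeter \<alpha> E K =
     (\<integral>\<^sup>+x\<in>E. (\<integral>\<^sup>+y\<in>- E. ennreal (body_norm K (x - y) powr (- real DIM('a) - \<alpha>)) \<partial>lborel) \<partial>lborel)"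

definition test_field :: "'a::euclidean_space set \<Rightarrow> ('a \<Rightarrow> 'a) \<Rightarrow> bool" where
  "test_field U \<phi> \<longleftrightarrow>
     (\<exists>\<phi>' :: 'a \<Rightarrow> 'a \<Rightarrow>\<^sub>L 'a. continuous_on UNIV \<phi>' \<and>
        (\<forall>x. (\<phi> has_derivative blinfun_apply (\<phi>' x)) (at x))) \<and>
     compact (closure {x. \<phi> x \<noteq> 0}) \<and> closure {x. \<phi> x \<noteq> 0} \<subseteq> U"

definition divergence :: "('a::euclidean_space \<Rightarrow> 'a) \<Rightarrow> 'a \<Rightarrow> real" where
  "divergence \<phi> x = (\<Sum>b\<in>Basis. frechet_derivative \<phi> (at x) b \<bullet> b)"

(* The gradient of a locally integrable f as a distribution, i.e. as a functional on
   compactly supported C^1 vector fields. *)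
definition dist_gradient :: "('a::euclidean_space \<Rightarrow> real) \<Rightarrow> ('a \<Rightarrow> 'a) \<Rightarrow> real" where
  "dist_gradient f \<phi> = - (\<integral>x. f x * divergence \<phi> x \<partial>lborel)"

(* |T|(U) for a vector-valued distribution T and an open set U. Negative values of T are
   truncated to 0 by ennreal, which is harmless because the zero field is admissible. *)
definition dist_variation ::
    "(('a::euclidean_space \<Rightarrow> 'a) \<Rightarrow> real) \<Rightarrow> 'a set \<Rightarrow> ennreal" where
  "dist_variation T U =
     (SUP \<phi>\<in>{\<phi>. test_field U \<phi> \<and> (\<forall>x. norm (\<phi> x) \<le> 1)}. ennreal (T \<phi>))"

definition finite_perimeter :: "'a::euclidean_space set \<Rightarrow> bool" where
  "finite_perimeter E \<longleftrightarrow> dist_variation (dist_gradient (indicator E)) UNIV < \<infinity>"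

end

theory Submission
  imports Defs
begin

text \<open>
  Write \<open>N\<close> for the norm with unit ball \<open>K\<close>. Substituting \<open>z = x - y\<close> turns the fractional
  perimeter into the integral of \<open>N z powr (- d - \<alpha>) * |E - (E + z)|\<close>. Finite perimeter gives
  \<open>|E - (E + z)| \<le> P |z|\<close>, so the region \<open>N \<le> 1\<close> contributes a bounded amount, which the factor
  \<open>\<alpha>\<close> kills. On \<open>N > 1\<close> replace \<open>|E - (E + z)|\<close> by \<open>|E|\<close>: the kernel alone integrates to
  \<open>d |K| / \<alpha>\<close>, and the error is at most the integral of \<open>|E \<inter> (E + z)|\<close>, which is \<open>|E|\<^sup>2\<close>
  independently of \<open>\<alpha>\<close>.
\<close>

subsection \<open>The norm of a symmetric convex body\<close>

text \<open>Finite perimeter is given only as a supremum over compactly supported C^1 fields, so the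
  bound on translates is proved by duality. The set E is never smoothed: the indicator of E - (E +
  z) is replaced by C^1 cutoffs squeezed between a compact subset and an open superset, the
  translation is moved onto the cutoff, and the increment of the cutoff is an integral of
  divergences along a segment.

  The contribution of N \<le> 1 must be bounded uniformly in \<alpha> before the factor \<alpha> can
  remove it. The gained factor |z| raises the exponent of the kernel to 1 - d - \<alpha>, which is
  integrable near 0 with a bound that blows up only as \<alpha> approaches 1; hence the range
  \<alpha> \<le> 1/2.

  Both kernel integrals are computed from the volumes t^d |K| of the sets N \<le> t, through a
  layer-cake formula in place of polar coordinates.\<close>

text \<open>Symmetry turns an interior point c into the interior point -c, and convexity of the
  interior gives their midpoint 0. The inner ball will make every gauge set nonempty, the outer one
  will bound the Euclidean norm by a multiple of the gauge.\<close>

lemma origin_symmetric_convex_body_cball: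
  fixes K :: "'a::euclidean_space set"
  assumes "origin_symmetric_convex_body K"
  obtains r R where "0 < r" "0 < R" "cball 0 r \<subseteq> K" "K \<subseteq> cball 0 R"
proof -
  from assms have K: "compact K" "convex K" "interior K \<noteq> {}" "\<And>x. x \<in> K \<Longrightarrow> - x \<in> K"
    by (auto simp: origin_symmetric_convex_body_def)
  obtain c where c: "c \<in> interior K" using K(3) by auto
  have "uminus ` K = K"
    using K(4) by (auto simp: image_iff) (metis minus_minus)
  then have "- c \<in> interior K"
    using c interior_negations[of K] by auto
  then have "(1/2) *\<^sub>R c + (1/2) *\<^sub>R (- c) \<in> interior K"
    using c convexD[OF convex_interior[OF K(2)], of c "- c" "1/2" "1/2"] by auto
  then have "0 \<in> interior K" by simp
  then obtain r where r: "0 < r" "cball 0 r \<subseteq> K"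
    by (meson mem_interior_cball)
  obtain R where "0 < R" "K \<subseteq> cball 0 R"
    using compact_imp_bounded[OF K(1)] by (auto simp: bounded_pos subset_iff)
  with r show thesis using that by blast
qed

locale symmetric_body =
  fixes K :: "'a::euclidean_space set"
  assumes body: "origin_symmetric_convex_body K"
begin

abbreviation N :: "'a \<Rightarrow> real" where "N \<equiv> body_norm K"

lemma compact_K: "compact K" and convex_K: "convex K"
  using body by (auto simp: origin_symmetric_convex_body_def)

lemma zero_mem_K: "0 \<in> K"
  by (metis origin_symmetric_convex_body_cball[OF body] centre_in_cball less_imp_le subsetD)

text \<open>A convex set containing 0 is star-shaped about 0, and a larger divisor moves the point
  towards 0.\<close>

lemma gauge_set_upward:
  assumes "0 < l" "l \<le> m" "inverse l *\<^sub>R x \<in> K"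
  shows "inverse m *\<^sub>R x \<in> K"
proof -
  have "(l / m) *\<^sub>R (inverse l *\<^sub>R x) + (1 - l / m) *\<^sub>R 0 \<in> K"
    using assms convexD[OF convex_K assms(3) zero_mem_K, of "l / m" "1 - l / m"] by auto
  then show ?thesis using assms by (simp add: field_simps)
qed

lemma gauge_set_nonempty: "{l. 0 < l \<and> inverse l *\<^sub>R x \<in> K} \<noteq> {}"
proof -
  obtain r where r: "0 < r" "cball 0 r \<subseteq> K"
    using origin_symmetric_convex_body_cball[OF body] by metis
  \<comment> \<open>The summand 1 keeps the scalar positive at x = 0.\<close>
  have "inverse ((norm x + 1) / r) *\<^sub>R x \<in> K"
  proof -
    have "norm (inverse ((norm x + 1) / r) *\<^sub>R x) \<le> r"
      using r by (simp add: divide_le_eq mult_left_mono add_nonneg_pos)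
    then show ?thesis using r by auto
  qed
  moreover have "0 < (norm x + 1) / r"
    using r by (simp add: add_nonneg_pos)
  ultimately show ?thesis by blast
qed

lemma gauge_set_bdd_below: "bdd_below {l. 0 < l \<and> inverse l *\<^sub>R x \<in> K}"
  by (rule bdd_belowI[of _ 0]) auto

lemma body_norm_nonneg: "0 \<le> N x"
  unfolding body_norm_def by (rule cInf_greatest[OF gauge_set_nonempty]) auto

text \<open>The infimum is attained because K is closed: every s > t is admissible by upward
  closure, and s tends to t. Positivity of t keeps the inverse continuous there, which is why level
  0 is treated separately below.\<close>

lemma body_norm_le_iff:
  assumes "0 < t"
  shows "N x \<le> t \<longleftrightarrow> inverse t *\<^sub>R x \<in> K"
proof
  assume "inverse t *\<^sub>R x \<in> K"
  then show "N x \<le> t"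
    unfolding body_norm_def using assms by (intro cInf_lower gauge_set_bdd_below) auto
next
  assume le: "N x \<le> t"
  have mem: "inverse s *\<^sub>R x \<in> K" if "t < s" for s
  proof -
    have "Inf {l. 0 < l \<and> inverse l *\<^sub>R x \<in> K} < s"
      using le that by (simp add: body_norm_def)
    then obtain l where "0 < l" "inverse l *\<^sub>R x \<in> K" "l < s"
      using cInf_lessD[OF gauge_set_nonempty] by blast
    then show ?thesis using gauge_set_upward[of l s] by auto
  qed
  have "((\<lambda>s. inverse s *\<^sub>R x) \<longlongrightarrow> inverse t *\<^sub>R x) (at_right t)"
    using assms by (intro tendsto_intros) auto
  moreover have "\<forall>\<^sub>F s in at_right t. inverse s *\<^sub>R x \<in> K"
    using mem by (auto simp: eventually_at_filter)
  ultimately show "inverse t *\<^sub>R x \<in> K"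
    using Lim_in_closed_set[OF compact_imp_closed[OF compact_K]] by (metis trivial_limit_at_right_real)
qed

lemma sublevel_body_norm:
  assumes "0 < t"
  shows "{x. N x \<le> t} = (*\<^sub>R) t ` K"
proof (intro set_eqI iffI)
  fix x assume "x \<in> {x. N x \<le> t}"
  then have "inverse t *\<^sub>R x \<in> K" using body_norm_le_iff[OF assms] by simp
  then have "t *\<^sub>R (inverse t *\<^sub>R x) \<in> (*\<^sub>R) t ` K" by blast
  then show "x \<in> (*\<^sub>R) t ` K" using assms by simp
next
  fix x assume "x \<in> (*\<^sub>R) t ` K"
  then show "x \<in> {x. N x \<le> t}" using assms by (auto simp: body_norm_le_iff)
qed

text \<open>Converts the Euclidean length in the perimeter bound into the gauge; it also shows that
  the gauge vanishes only at the origin.\<close>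

lemma norm_le_body_norm: "\<exists>R>0. \<forall>x. norm x \<le> R * N x"
proof -
  obtain R where R: "0 < R" "K \<subseteq> cball 0 R"
    using origin_symmetric_convex_body_cball[OF body] by metis
  have "norm x \<le> R * N x" for x
  proof -
    have "norm x / R \<le> N x"
      unfolding body_norm_def
    proof (rule cInf_greatest[OF gauge_set_nonempty])
      fix l assume "l \<in> {l. 0 < l \<and> inverse l *\<^sub>R x \<in> K}"
      then have "0 < l" "norm (inverse l *\<^sub>R x) \<le> R" using R by auto
      then show "norm x / R \<le> l" using R by (simp add: field_simps)
    qed
    then show ?thesis using R by (simp add: field_simps)
  qed
  with R show ?thesis by blast
qed

lemma body_norm_le_0_iff: "N x \<le> 0 \<longleftrightarrow> x = 0"
proof
  assume "N x \<le> 0"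
  moreover obtain R where "0 < R" "norm x \<le> R * N x" using norm_le_body_norm by blast
  ultimately have "norm x \<le> 0" by (smt (verit) mult_nonneg_nonpos)
  then show "x = 0" by simp
next
  assume "x = 0"
  then have "N x \<le> 0 + t" if "0 < t" for t
    using that body_norm_le_iff[OF that] zero_mem_K by simp
  then show "N x \<le> 0" by (rule field_le_epsilon)
qed

lemma closed_sublevel_body_norm: "0 < t \<Longrightarrow> closed {x. N x \<le> t}"
  by (simp add: sublevel_body_norm compact_imp_closed compact_scaling compact_K)

lemma borel_measurable_body_norm [measurable]: "N \<in> borel_measurable borel"
proof (subst borel_measurable_iff_le, intro allI)
  fix a :: real
  consider "a < 0" | "a = 0" | "0 < a" by linarith
  then show "{w \<in> space borel. N w \<le> a} \<in> sets borel"
  proof cases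
    case 1
    then have "{w \<in> space borel. N w \<le> a} = {}" using body_norm_nonneg by (auto simp: not_le intro: less_le_trans)
    then show ?thesis by (metis sets.empty_sets)
  next
    case 2
    then have "{w \<in> space borel. N w \<le> a} = {0}" using body_norm_le_0_iff by auto
    then show ?thesis by simp
  next
    case 3
    then show ?thesis using closed_sublevel_body_norm[of a] by (simp add: borel_closed)
  qed
qed

lemma emeasure_sublevel_body_norm:
  assumes "0 < t"
  shows "emeasure lborel {x. N x \<le> t} = ennreal (t ^ DIM('a)) * emeasure lborel K"
proof -
  have "emeasure lebesgue ((*\<^sub>R) t ` K) = ennreal (\<bar>t\<bar> ^ DIM('a)) * emeasure lebesgue K"
    using emeasure_lebesgue_affine[of t 0 K] by simp
  moreover have "(*\<^sub>R) t ` K \<in> sets borel" "K \<in> sets borel"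
    by (simp_all add: borel_compact compact_scaling compact_K)
  ultimately show ?thesis
    using assms by (simp add: sublevel_body_norm)
qed

lemma emeasure_K: "emeasure lborel K = ennreal (measure lborel K)"
  using emeasure_bounded_finite[OF compact_imp_bounded[OF compact_K]]
  by (simp add: emeasure_eq_ennreal_measure less_top)

lemma emeasure_shell_body_norm:
  assumes "1 \<le> t"
  shows "emeasure lborel {x. 1 < N x \<and> N x \<le> t} = ennreal ((t ^ DIM('a) - 1) * measure lborel K)"
proof -
  have "{x. 1 < N x \<and> N x \<le> t} = {x. N x \<le> t} - {x. N x \<le> 1}"
    by auto
  moreover have "emeasure lborel ({x. N x \<le> t} - {x. N x \<le> 1}) =
      emeasure lborel {x. N x \<le> t} - emeasure lborel {x. N x \<le> 1}"
    using assms by (intro emeasure_Diff) (auto simp: emeasure_sublevel_body_norm emeasure_K ennreal_mult'[symmetric])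
  ultimately show ?thesis
    using assms by (simp add: emeasure_sublevel_body_norm emeasure_K ennreal_mult'[symmetric]
      ennreal_minus[symmetric] ring_distribs flip: ennreal_minus)
qed

end

section \<open>Integrals of powers of the norm outside and inside the unit ball\<close>

text \<open>The weight is minus the derivative of the power, so a negative power becomes an integral
  over all levels above its base.\<close>

lemma nn_integral_powr_atLeast:
  fixes p n :: real
  assumes "0 < p" "0 < n"
  shows "(\<integral>\<^sup>+t. ennreal (p * t powr (- p - 1)) * indicator {n..} t \<partial>lborel) = ennreal (n powr (- p))"
proof -
  have "((\<lambda>t. p * t powr (- p - 1)) has_integral p * (- (n powr (- p - 1 + 1)) / (- p - 1 + 1))) {n..}"
    using assms by (intro has_integral_mult_right has_integral_powr_to_inf) auto
  then have "((\<lambda>t. p * t powr (- p - 1)) has_integral n powr (- p)) {n..}"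
    using assms by simp
  from nn_integral_has_integral_lebesgue[OF _ this] assms show ?thesis
    by (simp add: ennreal_mult' mult.commute ennreal_indicator)
qed

text \<open>Apply the preceding formula with base f x and exchange the integrals; the condition t
  \<ge> f x then describes a sublevel set. For the gauge these sets are dilates of K, so a
  one-dimensional integral of known volumes remains.\<close>

lemma nn_integral_powr_neg_layer_cake:
  fixes f :: "'a::euclidean_space \<Rightarrow> real"
  assumes [measurable]: "f \<in> borel_measurable borel" "S \<in> sets borel"
    and p: "0 < p" and pos: "\<And>x. x \<in> S \<Longrightarrow> 0 < f x"
  shows "(\<integral>\<^sup>+x\<in>S. ennreal (f x powr (- p)) \<partial>lborel) =
    (\<integral>\<^sup>+t. ennreal (p * t powr (- p - 1)) * emeasure lborel {x\<in>S. f x \<le> t} \<partial>lborel)"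
proof -
  have "(\<integral>\<^sup>+x\<in>S. ennreal (f x powr (- p)) \<partial>lborel) =
    (\<integral>\<^sup>+x. (\<integral>\<^sup>+t. ennreal (p * t powr (- p - 1)) * indicator {x\<in>S. f x \<le> t} x \<partial>lborel) \<partial>lborel)"
  proof (intro nn_integral_cong)
    fix x
    show "ennreal (f x powr (- p)) * indicator S x =
        (\<integral>\<^sup>+t. ennreal (p * t powr (- p - 1)) * indicator {x\<in>S. f x \<le> t} x \<partial>lborel)"
    proof (cases "x \<in> S")
      case True
      then have "(\<lambda>t. indicator {x\<in>S. f x \<le> t} x :: ennreal) = indicator {f x..}"
        by (auto simp: indicator_def fun_eq_iff)
      then show ?thesis
        using nn_integral_powr_atLeast[OF p pos[OF True]] True by (simp add: fun_eq_iff)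
    qed simp
  qed
  also have "\<dots> = (\<integral>\<^sup>+t. (\<integral>\<^sup>+x. ennreal (p * t powr (- p - 1)) * indicator {x\<in>S. f x \<le> t} x \<partial>lborel) \<partial>lborel)"
  proof (rule lborel_pair.Fubini')
    \<comment> \<open>The exchange needs joint measurability in (t, x), so the sublevel condition is
      first expressed as one set in the product.\<close>
    have "{z \<in> space (lborel \<Otimes>\<^sub>M lborel). snd z \<in> S \<and> f (snd z) \<le> fst z} \<in> sets (lborel \<Otimes>\<^sub>M lborel)"
      by measurable
    then have "{z :: real \<times> 'a. snd z \<in> S \<and> f (snd z) \<le> fst z} \<in> sets (lborel \<Otimes>\<^sub>M lborel)"
      by (simp add: space_pair_measure)
    then have [measurable]: "(\<lambda>z. indicator {z :: real \<times> 'a. snd z \<in> S \<and> f (snd z) \<le> fst z} z :: ennreal) \<in>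
        borel_measurable (lborel \<Otimes>\<^sub>M lborel)"
      by (rule borel_measurable_indicator)
    have "(\<lambda>z. ennreal (p * fst z powr (- p - 1)) *
        indicator {z :: real \<times> 'a. snd z \<in> S \<and> f (snd z) \<le> fst z} z) \<in>
        borel_measurable (lborel \<Otimes>\<^sub>M lborel)"
      by measurable
    then show "(\<lambda>(t, x). ennreal (p * t powr (- p - 1)) * indicator {x\<in>S. f x \<le> t} x) \<in>
        borel_measurable (lborel \<Otimes>\<^sub>M lborel)"
      by (simp add: indicator_def case_prod_beta')
  qed
  also have "\<dots> = (\<integral>\<^sup>+t. ennreal (p * t powr (- p - 1)) * emeasure lborel {x\<in>S. f x \<le> t} \<partial>lborel)"
    by (intro nn_integral_cong nn_integral_cmult_indicator) measurable
  finally show ?thesis .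
qed

context symmetric_body
begin

text \<open>With p = d + \<alpha>, the shell volumes (t^d - 1) |K| leave the difference of the
  powers with exponents -\<alpha> - 1 and -p - 1. Its integral gives p (1/\<alpha> - 1/p) =
  d/\<alpha>, which is the source of the factor d in the limit.\<close>

lemma nn_integral_body_norm_outside:
  assumes "0 < \<alpha>"
  shows "(\<integral>\<^sup>+x\<in>{x. 1 < N x}. ennreal (N x powr (- real DIM('a) - \<alpha>)) \<partial>lborel) =
    ennreal (DIM('a) * measure lborel K / \<alpha>)"
proof -
  define d where "d = real DIM('a)"
  define p where "p = d + \<alpha>"
  have d: "1 \<le> d" using DIM_positive[where 'a='a] unfolding d_def by linarith
  have p: "0 < p" using assms d by (simp add: p_def)
  have "(\<integral>\<^sup>+x\<in>{x. 1 < N x}. ennreal (N x powr (- real DIM('a) - \<alpha>)) \<partial>lborel) =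
    (\<integral>\<^sup>+t. ennreal (p * t powr (- p - 1)) * emeasure lborel {x\<in>{x. 1 < N x}. N x \<le> t} \<partial>lborel)"
    using p by (subst nn_integral_powr_neg_layer_cake[symmetric]) (auto simp: p_def d_def)
  also have "\<dots> = (\<integral>\<^sup>+t. ennreal (indicator {1..} t *
      (measure lborel K * (p * (t powr (- \<alpha> - 1) - t powr (- p - 1))))) \<partial>lborel)"
  proof (intro nn_integral_cong)
    fix t :: real
    show "ennreal (p * t powr (- p - 1)) * emeasure lborel {x\<in>{x. 1 < N x}. N x \<le> t} =
      ennreal (indicator {1..} t * (measure lborel K * (p * (t powr (- \<alpha> - 1) - t powr (- p - 1)))))"
    proof (cases "1 \<le> t")
      case True
      have "t ^ DIM('a) = t powr d" using True by (simp add: d_def powr_realpow)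
      then have "t powr (- p - 1) * t ^ DIM('a) = t powr (- \<alpha> - 1)"
        by (simp add: powr_add[symmetric] p_def)
      then have *: "measure lborel K * (p * (t powr (- \<alpha> - 1) - t powr (- p - 1))) =
          p * t powr (- p - 1) * ((t ^ DIM('a) - 1) * measure lborel K)"
        by (simp add: algebra_simps)
      have "ennreal (p * t powr (- p - 1)) * emeasure lborel {x\<in>{x. 1 < N x}. N x \<le> t} =
          ennreal (p * t powr (- p - 1) * ((t ^ DIM('a) - 1) * measure lborel K))"
        using True p by (simp add: emeasure_shell_body_norm ennreal_mult')
      then show ?thesis unfolding * using True by simp
    next
      case False
      then have "{x\<in>{x. 1 < N x}. N x \<le> t} = {}" by auto
      then show ?thesis using False by (simp only:) simp
    qed
  qed
  also have "\<dots> = ennreal (d * measure lborel K / \<alpha>)"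
  proof (rule nn_integral_has_integral_lebesgue)
    fix t :: real assume "t \<in> {1..}"
    then have "t powr (- p - 1) \<le> t powr (- \<alpha> - 1)"
      using d by (intro powr_mono) (auto simp: p_def)
    then show "0 \<le> measure lborel K * (p * (t powr (- \<alpha> - 1) - t powr (- p - 1)))"
      using p by simp
  next
    have "((\<lambda>t. measure lborel K * (p * (t powr (- \<alpha> - 1) - t powr (- p - 1)))) has_integral
      measure lborel K * (p * (- (1 powr (- \<alpha> - 1 + 1)) / (- \<alpha> - 1 + 1) - - (1 powr (- p - 1 + 1)) / (- p - 1 + 1)))) {1..}"
      using assms p by (intro has_integral_mult_right has_integral_diff has_integral_powr_to_inf) auto
    moreover have "measure lborel K * (p * (- (1 powr (- \<alpha> - 1 + 1)) / (- \<alpha> - 1 + 1) - - (1 powr (- p - 1 + 1)) / (- p - 1 + 1)))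
      = d * measure lborel K / \<alpha>"
    proof -
      have "p * (1 / \<alpha> - 1 / p) = p / \<alpha> - 1" using p by (simp add: right_diff_distrib)
      also have "\<dots> = d / \<alpha>" using assms by (simp add: p_def add_divide_distrib)
      finally show ?thesis by simp
    qed
    ultimately show "((\<lambda>t. measure lborel K * (p * (t powr (- \<alpha> - 1) - t powr (- p - 1)))) has_integral
      d * measure lborel K / \<alpha>) {1..}" by simp
  qed
  finally show ?thesis by (simp add: d_def)
qed

text \<open>The exponent exceeds that of the kernel by 1 because the perimeter bound supplies a
  factor N. Levels below 1 contribute p |K| / (1 - \<alpha>) with p = d - 1 + \<alpha> \<le> d, at
  most 2 d |K| for \<alpha> \<le> 1/2; levels above 1 contribute |K|.\<close>

lemma nn_integral_body_norm_inside:
  assumes "0 < \<alpha>" "\<alpha> \<le> 1/2"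
  shows "(\<integral>\<^sup>+x\<in>{x. 0 < N x \<and> N x \<le> 1}. ennreal (N x powr (1 - real DIM('a) - \<alpha>)) \<partial>lborel) \<le>
    ennreal ((2 * real DIM('a) + 1) * measure lborel K)"
proof -
  define d where "d = real DIM('a)"
  define p where "p = d - 1 + \<alpha>"
  define k where "k = measure lborel K"
  have d: "1 \<le> d" using DIM_positive[where 'a='a] unfolding d_def by linarith
  have p: "0 < p" using assms d by (simp add: p_def)
  have k: "0 \<le> k" by (simp add: k_def)
  have "(\<integral>\<^sup>+x\<in>{x. 0 < N x \<and> N x \<le> 1}. ennreal (N x powr (1 - real DIM('a) - \<alpha>)) \<partial>lborel) =
    (\<integral>\<^sup>+t. ennreal (p * t powr (- p - 1)) * emeasure lborel {x\<in>{x. 0 < N x \<and> N x \<le> 1}. N x \<le> t} \<partial>lborel)"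
    using p by (subst nn_integral_powr_neg_layer_cake[symmetric]) (auto simp: p_def d_def algebra_simps)
  \<comment> \<open>The volume is at most t^d |K| below level 1 and at most |K| above it. Both terms
    count at t = 1, which an upper bound permits. The factor p stays inside the tail, which
    integrates to 1 even when d = 1 and p = \<alpha> is small.\<close>
  also have "\<dots> \<le> (\<integral>\<^sup>+t. ennreal (indicator {0..1} t * (k * (p * t powr (- \<alpha>)))) +
      ennreal (indicator {1..} t * (k * (p * t powr (- p - 1)))) \<partial>lborel)"
  proof (intro nn_integral_mono)
    fix t :: real
    let ?A = "{x\<in>{x. 0 < N x \<and> N x \<le> 1}. N x \<le> t}"
    consider "t \<le> 0" | "0 < t" "t < 1" | "1 \<le> t" by linarith
    then show "ennreal (p * t powr (- p - 1)) * emeasure lborel ?A \<le>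
      ennreal (indicator {0..1} t * (k * (p * t powr (- \<alpha>)))) +
      ennreal (indicator {1..} t * (k * (p * t powr (- p - 1))))"
    proof cases
      case 1
      then have "?A = {}" by auto
      then show ?thesis by (simp only:) simp
    next
      case 2
      have "t ^ DIM('a) = t powr d" using 2 by (simp add: d_def powr_realpow)
      then have *: "t powr (- p - 1) * t ^ DIM('a) = t powr (- \<alpha>)"
        by (simp add: powr_add[symmetric] p_def)
      have "emeasure lborel ?A \<le> emeasure lborel {x. N x \<le> t}"
        by (intro emeasure_mono) auto
      also have "\<dots> = ennreal (t ^ DIM('a) * k)"
        using 2 by (simp add: emeasure_sublevel_body_norm emeasure_K k_def ennreal_mult')
      finally have "ennreal (p * t powr (- p - 1)) * emeasure lborel ?A \<le>
        ennreal (p * t powr (- p - 1)) * ennreal (t ^ DIM('a) * k)"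
        by (rule mult_left_mono) simp
      also have "\<dots> = ennreal (k * (p * (t powr (- p - 1) * t ^ DIM('a))))"
        using p by (subst ennreal_mult'[symmetric]) (simp_all add: mult_ac)
      finally show ?thesis using 2 * by simp
    next
      case 3
      have "emeasure lborel ?A \<le> emeasure lborel {x. N x \<le> 1}"
        by (intro emeasure_mono) auto
      also have "\<dots> = ennreal k"
        by (simp add: emeasure_sublevel_body_norm emeasure_K k_def)
      finally have "ennreal (p * t powr (- p - 1)) * emeasure lborel ?A \<le>
        ennreal (p * t powr (- p - 1)) * ennreal k"
        by (rule mult_left_mono) simp
      also have "\<dots> = ennreal (k * (p * t powr (- p - 1)))"
        using p by (subst ennreal_mult'[symmetric]) (simp_all add: mult_ac)
      finally show ?thesis using 3 by (simp add: add_increasing)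
    qed
  qed
  also have "\<dots> = (\<integral>\<^sup>+t. ennreal (indicator {0..1} t * (k * (p * t powr (- \<alpha>)))) \<partial>lborel) +
      (\<integral>\<^sup>+t. ennreal (indicator {1..} t * (k * (p * t powr (- p - 1)))) \<partial>lborel)"
    by (rule nn_integral_add) measurable
  also have "\<dots> = ennreal (k * (p * (1 / (1 - \<alpha>)))) + ennreal (k * 1)"
  proof (intro arg_cong2[of _ _ _ _ "(+)"] nn_integral_has_integral_lebesgue)
    have "((\<lambda>t. t powr (- \<alpha>)) has_integral 1 powr (- \<alpha> + 1) / (- \<alpha> + 1)) {0..1}"
      using assms by (intro has_integral_powr_from_0) auto
    then show "((\<lambda>t. k * (p * t powr (- \<alpha>))) has_integral k * (p * (1 / (1 - \<alpha>)))) {0..1}"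
      by (intro has_integral_mult_right) simp
    have "((\<lambda>t. p * t powr (- p - 1)) has_integral p * (- (1 powr (- p - 1 + 1)) / (- p - 1 + 1))) {1..}"
      using p by (intro has_integral_mult_right has_integral_powr_to_inf) auto
    then show "((\<lambda>t. k * (p * t powr (- p - 1))) has_integral k * 1) {1..}"
      using p by (intro has_integral_mult_right) simp
  qed (use p k in auto)
  also have "\<dots> \<le> ennreal ((2 * d + 1) * k)"
  proof -
    have "1 / (1 - \<alpha>) \<le> 2" using assms by (simp add: field_simps)
    then have "p * (1 / (1 - \<alpha>)) \<le> d * 2"
      using p d assms by (intro mult_mono) (auto simp: p_def)
    then have "k * (p * (1 / (1 - \<alpha>))) \<le> k * (d * 2)" using k by (rule mult_left_mono)
    then have "k * (p * (1 / (1 - \<alpha>))) + k * 1 \<le> (2 * d + 1) * k" by (simp add: algebra_simps)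
    then show ?thesis using p k assms by (simp flip: ennreal_plus add: ennreal_leI)
  qed
  finally show ?thesis by (simp add: d_def k_def)
qed

end

subsection \<open>Translates of a set of finite perimeter\<close>

text \<open>The gradient is an explicit argument, so that the closure rules below can assemble it by
  unification when a cutoff is built.\<close>

definition has_C1_gradient :: "('a::euclidean_space \<Rightarrow> real) \<Rightarrow> ('a \<Rightarrow> 'a) \<Rightarrow> bool" where
  "has_C1_gradient \<psi> G \<longleftrightarrow>
     continuous_on UNIV G \<and> (\<forall>x. (\<psi> has_derivative (\<lambda>h. G x \<bullet> h)) (at x))"

lemma has_C1_gradient_continuous:
  assumes "has_C1_gradient \<psi> G"
  shows "continuous_on UNIV \<psi>"
  using assms unfolding has_C1_gradient_def
  by (meson continuous_at_imp_continuous_on has_derivative_continuous)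

lemma has_C1_gradient_const: "has_C1_gradient (\<lambda>x. c) (\<lambda>x. 0)"
  by (simp add: has_C1_gradient_def)

lemma has_C1_gradient_diff:
  assumes "has_C1_gradient f F" "has_C1_gradient g G"
  shows "has_C1_gradient (\<lambda>x. f x - g x) (\<lambda>x. F x - G x)"
  using assms by (auto simp: has_C1_gradient_def inner_diff_left intro: continuous_on_diff has_derivative_diff)

lemma has_C1_gradient_cmult:
  assumes "has_C1_gradient f F"
  shows "has_C1_gradient (\<lambda>x. c * f x) (\<lambda>x. c *\<^sub>R F x)"
  using assms by (auto simp: has_C1_gradient_def intro!: continuous_intros has_derivative_mult_right)

lemma has_C1_gradient_sum:
  assumes "\<And>i. i \<in> I \<Longrightarrow> has_C1_gradient (f i) (F i)"
  shows "has_C1_gradient (\<lambda>x. \<Sum>i\<in>I. f i x) (\<lambda>x. \<Sum>i\<in>I. F i x)"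
  using assms by (auto simp: has_C1_gradient_def inner_sum_left intro!: continuous_intros has_derivative_sum)

lemma has_C1_gradient_norm_power2: "has_C1_gradient (\<lambda>x. (norm (x - a))\<^sup>2) (\<lambda>x. 2 *\<^sub>R (x - a))"
  unfolding has_C1_gradient_def power2_norm_eq_inner
  by (auto intro!: continuous_intros derivative_eq_intros simp: inner_commute)

text \<open>Squaring removes the kink at 0, where the difference quotient is at most |h|. Truncated
  polynomials thereby become C^1, the regularity that test fields require.\<close>

lemma DERIV_pos_part_power2: "((\<lambda>t. (max 0 t)\<^sup>2) has_real_derivative 2 * max 0 t) (at t)"
proof -
  consider "t < 0" | "t = 0" | "0 < t" by linarith
  then show ?thesis
  proof cases
    case 1
    have "((\<lambda>t. 0) has_real_derivative 2 * max 0 t) (at t)" using 1 by (auto intro!: derivative_eq_intros)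
    then show ?thesis
      by (rule has_field_derivative_transform_within_open[where S = "{..<0}"]) (use 1 in auto)
  next
    case 2
    have "(\<lambda>h. (max 0 (0 + h))\<^sup>2 / h) \<midarrow>0\<rightarrow> (0::real)"
    proof (rule Lim_null_comparison[where g = "\<lambda>h. \<bar>h\<bar>"])
      show "\<forall>\<^sub>F h in at 0. norm ((max 0 (0 + h))\<^sup>2 / h) \<le> \<bar>h :: real\<bar>"
        by (intro always_eventually) (auto simp: max_def power2_eq_square)
      show "(\<lambda>h. \<bar>h :: real\<bar>) \<midarrow>0\<rightarrow> 0" by (rule tendsto_eq_intros | simp)+
    qed
    then show ?thesis using 2 by (simp add: DERIV_def)
  next
    case 3
    have "((\<lambda>t. t\<^sup>2) has_real_derivative 2 * max 0 t) (at t)" using 3 by (auto intro!: derivative_eq_intros)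
    then show ?thesis
      by (rule has_field_derivative_transform_within_open[where S = "{0<..}"]) (use 3 in auto)
  qed
qed

lemma has_C1_gradient_pos_part_power2:
  assumes "has_C1_gradient f F"
  shows "has_C1_gradient (\<lambda>x. (max 0 (f x))\<^sup>2) (\<lambda>x. (2 * max 0 (f x)) *\<^sub>R F x)"
  unfolding has_C1_gradient_def
proof (intro conjI allI)
  show "continuous_on UNIV (\<lambda>x. (2 * max 0 (f x)) *\<^sub>R F x)"
    using assms has_C1_gradient_continuous[OF assms]
    by (auto simp: has_C1_gradient_def intro!: continuous_intros)
  fix x
  have "(f has_derivative (\<lambda>h. F x \<bullet> h)) (at x)" using assms by (simp add: has_C1_gradient_def)
  from DERIV_compose_FDERIV[OF DERIV_pos_part_power2 this]
  show "((\<lambda>x. (max 0 (f x))\<^sup>2) has_derivative (\<lambda>h. (2 * max 0 (f x)) *\<^sub>R F x \<bullet> h)) (at x)"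
    by (simp add: mult.commute)
qed

text \<open>A sum of bumps \<open>(max 0 (1 - |y - x|\<^sup>2 / r\<^sup>2))\<^sup>2\<close> is positive on \<open>C\<close>; it is
  flattened to \<open>1\<close> above its minimum there.\<close>

lemma C1_Urysohn:
  fixes C U :: "'a::euclidean_space set"
  assumes "compact C" "open U" "C \<subseteq> U"
  obtains \<psi> G where "has_C1_gradient \<psi> G" "\<And>x. 0 \<le> \<psi> x" "\<And>x. \<psi> x \<le> 1" "\<And>x. x \<in> C \<Longrightarrow> \<psi> x = 1"
    "bounded {x. \<psi> x \<noteq> 0}" "\<And>x. x \<notin> U \<Longrightarrow> \<psi> x = 0"
proof -
  have "\<exists>r>0. cball x r \<subseteq> U" if "x \<in> C" for x
    using assms that open_contains_cball by (metis subsetD)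
  then obtain r where r: "\<And>x. x \<in> C \<Longrightarrow> 0 < r x" "\<And>x. x \<in> C \<Longrightarrow> cball x (r x) \<subseteq> U" by metis
  have "C \<subseteq> (\<Union>x\<in>C. ball x (r x))" using r(1) by force
  then obtain D where D: "D \<subseteq> C" "finite D" "C \<subseteq> (\<Union>x\<in>D. ball x (r x))"
    using compactE_image[OF assms(1), of C "\<lambda>x. ball x (r x)"] by auto
  define \<beta> where "\<beta> x y = (max 0 (1 - (1 / (r x)\<^sup>2) * (norm (y - x))\<^sup>2))\<^sup>2" for x y
  define S where "S y = (\<Sum>x\<in>D. \<beta> x y)" for y
  have "\<exists>SG. has_C1_gradient S SG"
    unfolding S_def[abs_def] \<beta>_def
    by (rule exI, rule has_C1_gradient_sum, rule has_C1_gradient_pos_part_power2, rule has_C1_gradient_diff,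
      rule has_C1_gradient_const, rule has_C1_gradient_cmult, rule has_C1_gradient_norm_power2)
  then obtain SG where SG: "has_C1_gradient S SG" by blast
  have S_nonneg: "0 \<le> S y" for y by (auto simp: S_def \<beta>_def intro!: sum_nonneg)
  have \<beta>_pos: "0 < \<beta> x y" if "x \<in> D" "y \<in> ball x (r x)" for x y
  proof -
    have "0 < r x" "norm (y - x) < r x" using that D(1) r(1) by (auto simp: dist_norm norm_minus_commute)
    then have "(norm (y - x))\<^sup>2 < (r x)\<^sup>2" by (intro power_strict_mono) auto
    then have "0 < 1 - (1 / (r x)\<^sup>2) * (norm (y - x))\<^sup>2" using \<open>0 < r x\<close> by (simp add: divide_less_eq)
    then show ?thesis
      unfolding \<beta>_def by (intro zero_less_power less_le_trans[OF _ max.cobounded2])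
  qed
  have \<beta>_zero: "\<beta> x y = 0" if "x \<in> D" "y \<notin> cball x (r x)" for x y
  proof -
    have "0 < r x" "r x < norm (y - x)" using that D(1) r(1) by (auto simp: dist_norm norm_minus_commute)
    then have "(r x)\<^sup>2 < (norm (y - x))\<^sup>2" by (intro power_strict_mono) auto
    then have "1 - (1 / (r x)\<^sup>2) * (norm (y - x))\<^sup>2 \<le> 0"
      using \<open>0 < r x\<close> \<open>r x < norm (y - x)\<close> by (simp add: field_simps)
    then show ?thesis by (simp add: \<beta>_def)
  qed
  have S_pos: "0 < S y" if y: "y \<in> C" for y
  proof -
    obtain x where "x \<in> D" "y \<in> ball x (r x)" using y D(3) by blast
    then show ?thesis unfolding S_def using D(2) \<beta>_pos
      by (intro sum_pos2[of D x]) (auto simp: \<beta>_def)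
  qed
  \<comment> \<open>Compactness gives the positive minimum; for empty C any positive m, here 1, will
    do.\<close>
  have "\<exists>m>0. \<forall>y\<in>C. m \<le> S y"
  proof (cases "C = {}")
    case False
    then obtain x where "x \<in> C" "\<forall>y\<in>C. S x \<le> S y"
      using continuous_attains_inf[OF assms(1) False] has_C1_gradient_continuous[OF SG]
      by (meson continuous_on_subset subset_UNIV)
    then show ?thesis using S_pos by blast
  qed (auto intro: exI[of _ 1])
  then obtain m where m: "0 < m" "\<And>y. y \<in> C \<Longrightarrow> m \<le> S y" by blast
  \<comment> \<open>This is 1 where S \<ge> m and 0 where S = 0; a second squared positive part
    keeps it C^1.\<close>
  define \<psi> where "\<psi> y = 1 - (max 0 (1 - (1 / m) * S y))\<^sup>2" for y
  have "\<exists>G. has_C1_gradient \<psi> G"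
    unfolding \<psi>_def[abs_def]
    by (rule exI, rule has_C1_gradient_diff, rule has_C1_gradient_const, rule has_C1_gradient_pos_part_power2,
      rule has_C1_gradient_diff, rule has_C1_gradient_const, rule has_C1_gradient_cmult, rule SG)
  then obtain G where G: "has_C1_gradient \<psi> G" by blast
  have \<psi>_zero: "\<exists>x\<in>D. y \<in> cball x (r x)" if "\<psi> y \<noteq> 0" for y
  proof (rule ccontr)
    assume "\<not> ?thesis"
    then have "S y = 0" unfolding S_def by (intro sum.neutral) (use \<beta>_zero in blast)
    then show False using that by (simp add: \<psi>_def)
  qed
  show thesis
  proof (rule that[OF G])
    fix x
    have "max 0 (1 - (1 / m) * S x) \<le> 1" using S_nonneg[of x] m(1) by simp
    then have "(max 0 (1 - (1 / m) * S x))\<^sup>2 \<le> 1" by (intro power_le_one) auto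
    then show "0 \<le> \<psi> x" by (simp add: \<psi>_def)
    show "\<psi> x \<le> 1" by (simp add: \<psi>_def)
  next
    fix x assume "x \<in> C"
    then have "1 - (1 / m) * S x \<le> 0" using m by (simp add: field_simps)
    then show "\<psi> x = 1" by (simp add: \<psi>_def)
  next
    have "{x. \<psi> x \<noteq> 0} \<subseteq> (\<Union>x\<in>D. cball x (r x))" using \<psi>_zero by blast
    then show "bounded {x. \<psi> x \<noteq> 0}"
      using D(2) by (meson bounded_UN bounded_cball bounded_subset)
  next
    fix x assume "x \<notin> U"
    then show "\<psi> x = 0" using \<psi>_zero[of x] r(2) D(1) by blast
  qed
qed

text \<open>Off the closed support the gradient is 0 by uniqueness of derivatives, and on the
  compact closed support it is continuous. The bound provides the integrability for the exchange of
  integrals along a segment.\<close>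

lemma bounded_C1_gradient:
  assumes G: "has_C1_gradient \<psi> G" and bdd: "bounded {x. \<psi> x \<noteq> 0}"
  shows "bounded (range G)"
proof -
  let ?S = "closure {x. \<psi> x \<noteq> 0}"
  have "G x = 0" if "x \<notin> ?S" for x
  proof -
    have "((\<lambda>x. 0) has_derivative (\<lambda>h. 0)) (at x)" by simp
    then have "(\<psi> has_derivative (\<lambda>h. 0)) (at x)"
      by (rule has_derivative_transform_within_open[where s = "- ?S"])
        (use that closure_subset[of "{x. \<psi> x \<noteq> 0}"] in auto)
    moreover have "(\<psi> has_derivative (\<lambda>h. G x \<bullet> h)) (at x)" using G by (simp add: has_C1_gradient_def)
    ultimately have "(\<lambda>h. 0) = (\<lambda>h. G x \<bullet> h)" by (rule has_derivative_unique)
    then have "G x \<bullet> G x = 0" by metis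
    then show ?thesis by simp
  qed
  then have "range G \<subseteq> insert 0 (G ` ?S)" by blast
  moreover have "compact (G ` ?S)"
    using bdd G by (intro compact_continuous_image)
      (auto simp: has_C1_gradient_def intro: continuous_on_subset)
  ultimately show ?thesis by (meson bounded_insert bounded_subset compact_imp_bounded)
qed

section \<open>Cutoffs as test fields and the bound on translates\<close>

text \<open>For a cutoff times a constant vector the divergence is a directional derivative, so such
  fields test the variation of E in a single direction.\<close>

lemma shifted_test_field:
  fixes \<psi> :: "'a::euclidean_space \<Rightarrow> real"
  assumes G: "has_C1_gradient \<psi> G" and bdd: "bounded {x. \<psi> x \<noteq> 0}"
  shows "test_field UNIV (\<lambda>x. \<psi> (x + v) *\<^sub>R e)"
    and "divergence (\<lambda>x. \<psi> (x + v) *\<^sub>R e) x = G (x + v) \<bullet> e"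
proof -
  let ?\<phi> = "\<lambda>x. \<psi> (x + v) *\<^sub>R e"
  have bl: "bounded_linear (\<lambda>h. (G (x + v) \<bullet> h) *\<^sub>R e)" for x
    by (intro bounded_linear_intros)
  have der: "(?\<phi> has_derivative (\<lambda>h. (G (x + v) \<bullet> h) *\<^sub>R e)) (at x)" for x
  proof -
    have "(\<psi> has_derivative (\<lambda>h. G (x + v) \<bullet> h)) (at (x + v))" using G by (simp add: has_C1_gradient_def)
    then have "((\<lambda>x. \<psi> (x + v)) has_derivative (\<lambda>h. G (x + v) \<bullet> h)) (at x)"
      by (rule has_derivative_compose[rotated]) (auto intro!: derivative_eq_intros)
    then show ?thesis by (rule has_derivative_scaleR_left)
  qed
  have cont: "continuous_on UNIV (\<lambda>x. G (x + v))"
    using G by (auto simp: has_C1_gradient_def intro!: continuous_on_compose2[of UNIV G] continuous_intros)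
  \<comment> \<open>Continuity in operator norm follows from continuity on basis vectors, as the
    dimension is finite.\<close>
  have "continuous_on UNIV (\<lambda>x. Blinfun (\<lambda>h. (G (x + v) \<bullet> h) *\<^sub>R e))"
    by (rule continuous_on_blinfun_componentwise)
      (simp add: bounded_linear_Blinfun_apply[OF bl], intro continuous_intros cont)
  moreover have "(?\<phi> has_derivative blinfun_apply (Blinfun (\<lambda>h. (G (x + v) \<bullet> h) *\<^sub>R e))) (at x)" for x
    using der by (simp add: bounded_linear_Blinfun_apply[OF bl])
  moreover have "bounded {x. ?\<phi> x \<noteq> 0}"
  proof (rule bounded_subset)
    show "bounded ((\<lambda>x. - v + x) ` {x. \<psi> x \<noteq> 0})" by (rule bounded_translation[OF bdd])
    show "{x. ?\<phi> x \<noteq> 0} \<subseteq> (\<lambda>x. - v + x) ` {x. \<psi> x \<noteq> 0}"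
    proof
      fix x assume "x \<in> {x. ?\<phi> x \<noteq> 0}"
      then show "x \<in> (\<lambda>x. - v + x) ` {x. \<psi> x \<noteq> 0}" by (intro image_eqI[of _ _ "x + v"]) auto
    qed
  qed
  ultimately show "test_field UNIV ?\<phi>"
    unfolding test_field_def
    by (intro conjI exI[of _ "\<lambda>x. Blinfun (\<lambda>h. (G (x + v) \<bullet> h) *\<^sub>R e)"]) (auto simp: compact_closure)
  have "frechet_derivative ?\<phi> (at x) = (\<lambda>h. (G (x + v) \<bullet> h) *\<^sub>R e)"
    using frechet_derivative_at[OF der] by simp
  then show "divergence ?\<phi> x = G (x + v) \<bullet> e"
    by (simp add: divergence_def euclidean_inner[of "G (x + v)" e])
qed

lemma integral_lborel_shift:
  fixes f :: "'a::euclidean_space \<Rightarrow> real"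
  assumes [measurable]: "f \<in> borel_measurable borel"
  shows "(\<integral>x. f (c + x) \<partial>lborel) = (\<integral>x. f x \<partial>lborel)"
  using integral_distr[of "(+) c" lborel borel f] by (simp add: lborel_distr_plus)

lemma integrable_indicator_times_bounded:
  fixes f :: "'b \<Rightarrow> real"
  assumes [measurable]: "A \<in> sets M" "f \<in> borel_measurable M"
    and "emeasure M A < \<infinity>" "\<And>x. \<bar>f x\<bar> \<le> B"
  shows "integrable M (\<lambda>x. indicator A x * f x)"
proof (rule Bochner_Integration.integrable_bound)
  show "integrable M (\<lambda>x. B * indicator A x :: real)"
    using assms by (intro integrable_mult_right) auto
  have "\<bar>f x\<bar> \<le> \<bar>B\<bar>" for x using assms(4)[of x] by linarith
  then show "AE x in M. norm (indicator A x * f x) \<le> norm (B * indicator A x :: real)"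
    by (auto simp: indicator_def)
qed measurable

text \<open>The difference \<open>\<psi> (x + z) - \<psi> x\<close> is \<open>|z|\<close> times the average over \<open>0 \<le> t \<le> 1\<close> of the
  divergences of the admissible fields \<open>\<psi> (x + t z) z / |z|\<close>.\<close>

lemma integral_indicator_shift_le:
  fixes E :: "'a::euclidean_space set"
  assumes E [measurable]: "E \<in> sets borel" and fin: "emeasure lborel E < \<infinity>" and per: "finite_perimeter E"
    and G: "has_C1_gradient \<psi> G" and bdd: "bounded {x. \<psi> x \<noteq> 0}" and le1: "\<And>x. \<bar>\<psi> x\<bar> \<le> 1"
  shows "(\<integral>x. indicator E x * (\<psi> x - \<psi> (x + z)) \<partial>lborel) \<le>
    enn2real (dist_variation (dist_gradient (indicator E)) UNIV) * norm z"
proof (cases "z = 0")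
  case False
  define P where "P = enn2real (dist_variation (dist_gradient (indicator E)) UNIV)"
  define e where "e = (1 / norm z) *\<^sub>R z"
  have e: "norm e = 1" "z = norm z *\<^sub>R e" using False by (auto simp: e_def)
  have contG: "continuous_on UNIV G" using G by (simp add: has_C1_gradient_def)
  then have [measurable]: "G \<in> borel_measurable borel" by (rule borel_measurable_continuous_onI)
  obtain B where B: "\<And>x. norm (G x) \<le> B"
    using bounded_C1_gradient[OF G bdd] by (auto simp: bounded_iff)
  define F where "F t x = indicator {0..1} t * (indicator E x * (G (x + t *\<^sub>R z) \<bullet> z))" for t :: real and x
  \<comment> \<open>The minus sign in \<open>dist_gradient\<close> turns the upper bound P into a
    lower bound. The field points along the unit vector e to be admissible; multiplying by |z|
    restores z.\<close>
  have P: "- P * norm z \<le> (\<integral>x. indicator E x * (G (x + t *\<^sub>R z) \<bullet> z) \<partial>lborel)" for t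
  proof -
    let ?\<phi> = "\<lambda>x. \<psi> (x + t *\<^sub>R z) *\<^sub>R e"
    have "ennreal (dist_gradient (indicator E) ?\<phi>) \<le> dist_variation (dist_gradient (indicator E)) UNIV"
      unfolding dist_variation_def using shifted_test_field(1)[OF G bdd] le1 e
      by (intro SUP_upper) auto
    also have "\<dots> = ennreal P"
      using per by (simp add: P_def finite_perimeter_def)
    finally have "dist_gradient (indicator E) ?\<phi> \<le> P" by (simp add: P_def)
    then have "- P \<le> (\<integral>x. indicator E x * (G (x + t *\<^sub>R z) \<bullet> e) \<partial>lborel)"
      by (simp add: dist_gradient_def shifted_test_field(2)[OF G bdd])
    then have "norm z * - P \<le> norm z * (\<integral>x. indicator E x * (G (x + t *\<^sub>R z) \<bullet> e) \<partial>lborel)"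
      by (rule mult_left_mono) simp
    also have "\<dots> = (\<integral>x. indicator E x * (G (x + t *\<^sub>R z) \<bullet> (norm z *\<^sub>R e)) \<partial>lborel)"
      by (simp add: mult_ac flip: integral_mult_right_zero)
    finally show ?thesis using e(2) by (simp add: mult.commute)
  qed
  \<comment> \<open>The integrand is bounded and lives on the product of the unit interval with E, a
    set of finite measure.\<close>
  have int: "integrable (lborel \<Otimes>\<^sub>M lborel) (\<lambda>(t, x). F t x)"
  proof -
    have "integrable (lborel \<Otimes>\<^sub>M lborel) (\<lambda>w. indicator ({0..1} \<times> E) w * (G (snd w + fst w *\<^sub>R z) \<bullet> z))"
    proof (rule integrable_indicator_times_bounded)
      show "emeasure (lborel \<Otimes>\<^sub>M lborel) ({0..1::real} \<times> E) < \<infinity>"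
        using fin by (subst lborel.emeasure_pair_measure_Times) auto
      show "\<bar>G (snd w + fst w *\<^sub>R z) \<bullet> z\<bar> \<le> B * norm z" for w
        by (meson B Cauchy_Schwarz_ineq2 mult_right_mono norm_ge_zero order_trans)
    qed measurable
    then show ?thesis by (simp add: F_def case_prod_beta' indicator_times mult.assoc)
  qed
  have FTC: "(\<integral>t. F t x \<partial>lborel) = indicator E x * (\<psi> (x + z) - \<psi> x)" for x
  proof -
    have "(\<integral>t. indicator {0..1} t *\<^sub>R (G (x + t *\<^sub>R z) \<bullet> z) \<partial>lborel) = \<psi> (x + 1 *\<^sub>R z) - \<psi> (x + 0 *\<^sub>R z)"
    proof (rule integral_FTC_Icc)
      fix t :: real
      have 1: "(\<psi> has_derivative (\<lambda>h. G (x + t *\<^sub>R z) \<bullet> h)) (at (x + t *\<^sub>R z))"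
        using G by (simp add: has_C1_gradient_def)
      have 2: "((\<lambda>t. x + t *\<^sub>R z) has_derivative (\<lambda>h. h *\<^sub>R z)) (at t within {0..1})"
        by (auto intro!: derivative_eq_intros)
      show "((\<lambda>t. \<psi> (x + t *\<^sub>R z)) has_vector_derivative G (x + t *\<^sub>R z) \<bullet> z) (at t within {0..1})"
        using has_derivative_compose[OF 2 1] by (simp add: has_vector_derivative_def)
    next
      show "continuous_on {0..1} (\<lambda>t. G (x + t *\<^sub>R z) \<bullet> z)"
        by (intro continuous_intros continuous_on_compose2[OF contG]) auto
    qed simp
    then show ?thesis
      by (simp add: F_def mult.left_commute[of "indicator {0..1} _"])
  qed
  have "- P * norm z = (\<integral>t. indicator {0..1::real} t * (- P * norm z) \<partial>lborel)" by simp
  also have "\<dots> \<le> (\<integral>t. \<integral>x. F t x \<partial>lborel \<partial>lborel)"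
  proof (rule integral_mono)
    show "integrable lborel (\<lambda>t. \<integral>x. F t x \<partial>lborel)"
      using lborel_pair.integrable_fst'[OF int] by simp
    show "indicator {0..1::real} t * (- P * norm z) \<le> (\<integral>x. F t x \<partial>lborel)" for t
      using P[of t] by (auto simp: F_def indicator_def)
  qed auto
  also have "\<dots> = (\<integral>x. \<integral>t. F t x \<partial>lborel \<partial>lborel)"
    using lborel_pair.Fubini_integral[OF int] by simp
  also have "\<dots> = - (\<integral>x. indicator E x * (\<psi> x - \<psi> (x + z)) \<partial>lborel)"
    by (simp add: FTC algebra_simps flip: integral_minus)
  finally show ?thesis by (simp add: P_def)
qed simp

text \<open>Inner regularity is applied to a finite measure, namely Lebesgue measure restricted to A
  by a density; the two agree on Borel subsets of A.\<close>

lemma inner_regular_lborel: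
  fixes A :: "'a::euclidean_space set"
  assumes A [measurable]: "A \<in> sets borel" and fin: "emeasure lborel A < \<infinity>" and "0 < e"
  obtains C where "compact C" "C \<subseteq> A" "measure lborel A < measure lborel C + e"
\<comment> \<open>A null set is split off because \<open>ennreal\<close> truncates negative numbers
  to 0, which would spoil the strict inequality between |A| - e and |A|.\<close>
proof (cases "measure lborel A = 0")
  case True
  then show thesis using \<open>0 < e\<close> by (intro that[of "{}"]) auto
next
  case False
  let ?M = "density lborel (indicator A)"
  have eq: "emeasure ?M B = emeasure lborel B" if "B \<subseteq> A" "B \<in> sets borel" for B
    using that by (simp add: emeasure_density Int_absorb1 flip: indicator_inter_arith)
  have "emeasure ?M A = (SUP C\<in>{C. C \<subseteq> A \<and> compact C}. emeasure ?M C)"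
    using fin by (intro inner_regular) (auto simp: emeasure_density)
  then have sup: "emeasure lborel A = (SUP C\<in>{C. C \<subseteq> A \<and> compact C}. emeasure lborel C)"
    by (simp add: eq borel_compact)
  have "ennreal (measure lborel A - e) < ennreal (measure lborel A)"
    using \<open>0 < e\<close> False measure_nonneg[of lborel A]
    by (intro ennreal_lessI) linarith+
  also have "\<dots> = emeasure lborel A"
    using fin by (simp add: emeasure_eq_ennreal_measure less_top)
  finally obtain C where C: "C \<subseteq> A" "compact C" "ennreal (measure lborel A - e) < emeasure lborel C"
    unfolding sup less_SUP_iff by auto
  have "emeasure lborel C = ennreal (measure lborel C)"
    using emeasure_bounded_finite[OF compact_imp_bounded[OF C(2)]]
    by (simp add: emeasure_eq_ennreal_measure less_top)
  then have "measure lborel A - e < measure lborel C"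
    using C(3) by (metis ennreal_less_iff ennreal_neg leI less_le_trans measure_nonneg not_le zero_less_measure_iff ennreal_leI)
  then show thesis using C by (intro that[of C]) auto
qed

text \<open>After a change of variables, the integral of 1_E(x) (\<psi>(x) - \<psi>(x + z)) becomes
  that of (1_E(x) - 1_E(x - z)) \<psi>(x). For the indicator of A in place of \<psi> this is |A|, so
  a cutoff close to that indicator yields |A| up to \<epsilon>.\<close>

lemma emeasure_shift_diff_le:
  fixes E :: "'a::euclidean_space set"
  assumes E [measurable]: "E \<in> sets borel" and fin: "emeasure lborel E < \<infinity>" and per: "finite_perimeter E"
  shows "emeasure lborel {x \<in> E. x - z \<notin> E} \<le>
    ennreal (enn2real (dist_variation (dist_gradient (indicator E)) UNIV) * norm z)"
proof -
  define P where "P = enn2real (dist_variation (dist_gradient (indicator E)) UNIV)"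
  define A where "A = {x \<in> E. x - z \<notin> E}"
  have "A = {x \<in> space borel. x \<in> E \<and> x - z \<notin> E}" by (simp add: A_def)
  also have "\<dots> \<in> sets borel" by measurable
  finally have A [measurable]: "A \<in> sets borel" .
  have "emeasure lborel A \<le> emeasure lborel E"
    by (rule emeasure_mono) (auto simp: A_def)
  then have finA: "emeasure lborel A < \<infinity>" using fin by simp
  have "measure lborel A \<le> P * norm z + \<epsilon>" if \<epsilon>: "0 < \<epsilon>" for \<epsilon>
  proof -
    obtain C where C: "compact C" "C \<subseteq> A" "measure lborel A < measure lborel C + \<epsilon> / 2"
      using inner_regular_lborel[OF A finA, of "\<epsilon> / 2"] \<epsilon> by (metis half_gt_zero)
    obtain U where U: "open U" "A \<subseteq> U" "emeasure lborel (U - A) < \<epsilon> / 2"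
      using outer_regular_lborel[OF A, of "\<epsilon> / 2"] \<epsilon> by (metis half_gt_zero)
    have [measurable]: "C \<in> sets borel" "U \<in> sets borel"
      using C(1) U(1) by (auto simp: borel_compact)
    have finC: "emeasure lborel C < \<infinity>" by (rule emeasure_bounded_finite[OF compact_imp_bounded[OF C(1)]])
    have finU: "emeasure lborel (U - A) < \<infinity>" using U(3) by (metis ennreal_less_top infinity_ennreal_def less_trans)
    have UA: "measure lborel (U - A) < \<epsilon> / 2"
      using U(3) finU \<epsilon> by (simp add: emeasure_eq_ennreal_measure less_top ennreal_less_iff)
    obtain \<psi> G where \<psi>: "has_C1_gradient \<psi> G" "\<And>x. 0 \<le> \<psi> x" "\<And>x. \<psi> x \<le> 1" "\<And>x. x \<in> C \<Longrightarrow> \<psi> x = 1"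
        "bounded {x. \<psi> x \<noteq> 0}" "\<And>x. x \<notin> U \<Longrightarrow> \<psi> x = 0"
      using C1_Urysohn[OF C(1) U(1)] C(2) U(2) by (metis order_trans)
    have abs1: "\<bar>\<psi> x\<bar> \<le> 1" for x using \<psi>(2,3)[of x] by simp
    have [measurable]: "\<psi> \<in> borel_measurable borel"
      using has_C1_gradient_continuous[OF \<psi>(1)] by (rule borel_measurable_continuous_onI)
    have int1: "integrable lborel (\<lambda>x. indicator E x * \<psi> x)"
      and int2: "integrable lborel (\<lambda>x. indicator E x * \<psi> (x + z))"
      using fin abs1 by (auto intro!: integrable_indicator_times_bounded[where B = 1])
    have int3: "integrable lborel (\<lambda>x. indicator E (x - z) * \<psi> x)"
    proof -
      have "integrable (distr lborel borel ((+) (- z))) (\<lambda>x. indicator E x * \<psi> (x + z))"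
        using int2 by (simp add: lborel_distr_plus)
      then have "integrable lborel (\<lambda>x. indicator E (- z + x) * \<psi> (- z + x + z))"
        by (subst (asm) integrable_distr_eq) auto
      then show ?thesis by simp
    qed
    have shift: "(\<integral>x. indicator E x * \<psi> (x + z) \<partial>lborel) = (\<integral>x. indicator E (x - z) * \<psi> x \<partial>lborel)"
      using integral_lborel_shift[of "\<lambda>x. indicator E x * \<psi> (x + z)" "- z"] by simp
    have "measure lborel C - measure lborel (U - A) =
        (\<integral>x. indicator C x - indicator (U - A) x \<partial>lborel)"
      using finC finU by simp
    also have "\<dots> \<le> (\<integral>x. indicator E x * \<psi> x - indicator E (x - z) * \<psi> x \<partial>lborel)"
    proof (rule integral_mono)
      fix x
      \<comment> \<open>On A the right side is \<psi>, which is 1 on C and nonnegative elsewhere.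
        Off A it is 0 or -\<psi>, and since \<psi> \<le> 1 vanishes off U, at most the indicator of
        U - A is lost.\<close>
      show "indicator C x - indicator (U - A) x \<le> indicator E x * \<psi> x - indicator E (x - z) * \<psi> x"
      proof (cases "x \<in> A")
        case True
        then show ?thesis using \<psi>(2,4)[of x] by (auto simp: A_def indicator_def)
      next
        case False
        then have "x \<notin> C" using C(2) by blast
        then show ?thesis using False \<psi>(2,3,6)[of x] by (auto simp: A_def indicator_def)
      qed
    qed (use finC finU int1 int3 in auto)
    also have "\<dots> = (\<integral>x. indicator E x * (\<psi> x - \<psi> (x + z)) \<partial>lborel)"
      using int1 int2 int3 shift by (simp add: right_diff_distrib)
    also have "\<dots> \<le> P * norm z"
      unfolding P_def by (rule integral_indicator_shift_le[OF E fin per \<psi>(1,5) abs1])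
    finally show ?thesis using UA C(3) by linarith
  qed
  then have "measure lborel A \<le> P * norm z" by (rule field_le_epsilon)
  then show ?thesis
    using finA by (simp add: A_def[symmetric] P_def[symmetric] emeasure_eq_ennreal_measure less_top ennreal_leI)
qed

subsection \<open>The limit\<close>

lemma nn_integral_lborel_reflect:
  fixes f :: "'a::euclidean_space \<Rightarrow> ennreal"
  assumes [measurable]: "f \<in> borel_measurable borel"
  shows "(\<integral>\<^sup>+x. f (c - x) \<partial>lborel) = (\<integral>\<^sup>+x. f x \<partial>lborel)"
proof -
  have "lborel = density (distr lborel borel (\<lambda>x::'a. c + (-1) *\<^sub>R x)) (\<lambda>x. ennreal (\<bar>-1\<bar> ^ DIM('a)))"
    by (rule lborel_affine) simp
  then have "lborel = distr lborel borel (\<lambda>x::'a. c - x)"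
    by (simp add: density_1 one_ennreal_def[symmetric])
  then have "(\<integral>\<^sup>+x. f x \<partial>lborel) = (\<integral>\<^sup>+x. f x \<partial>distr lborel borel (\<lambda>x. c - x))"
    by simp
  also have "\<dots> = (\<integral>\<^sup>+x. f (c - x) \<partial>lborel)"
    by (rule nn_integral_distr) auto
  finally show ?thesis by simp
qed

text \<open>As an integral of a product depending on the parameter z, the volume is visibly
  measurable in z and fits the exchange of integrals.\<close>

lemma emeasure_shift_Int_eq:
  fixes A B :: "'a::euclidean_space set"
  assumes [measurable]: "A \<in> sets borel" "B \<in> sets borel"
  shows "emeasure lborel {x \<in> A. x - z \<in> B} = (\<integral>\<^sup>+x. indicator A x * indicator B (x - z) \<partial>lborel)"
proof -
  have "{x \<in> space borel. x \<in> A \<and> x - z \<in> B} \<in> sets borel" by measurable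
  then have "(\<integral>\<^sup>+x. indicator {x \<in> A. x - z \<in> B} x \<partial>lborel) = emeasure lborel {x \<in> A. x - z \<in> B}"
    by (intro nn_integral_indicator) simp
  moreover have "indicator {x \<in> A. x - z \<in> B} x = (indicator A x * indicator B (x - z) :: ennreal)" for x
    by (auto simp: indicator_def)
  ultimately show ?thesis by simp
qed

lemma borel_measurable_emeasure_shift_Int [measurable]:
  fixes A B :: "'a::euclidean_space set"
  assumes [measurable]: "A \<in> sets borel" "B \<in> sets borel"
  shows "(\<lambda>z. emeasure lborel {x \<in> A. x - z \<in> B}) \<in> borel_measurable borel"
  unfolding emeasure_shift_Int_eq[OF assms] by measurable

text \<open>Reflection y = x - z in the inner integral preserves Lebesgue measure; then the
  integrals are exchanged. The sets and the kernel are left general for two uses: B = - E with the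
  singular kernel gives the perimeter, B = E with kernel 1 gives |E|^2.\<close>

lemma nn_integral_interaction_eq:
  fixes A B :: "'a::euclidean_space set"
  assumes [measurable]: "A \<in> sets borel" "B \<in> sets borel" "k \<in> borel_measurable borel"
  shows "(\<integral>\<^sup>+x\<in>A. (\<integral>\<^sup>+y\<in>B. k (x - y) \<partial>lborel) \<partial>lborel) =
    (\<integral>\<^sup>+z. k z * emeasure lborel {x \<in> A. x - z \<in> B} \<partial>lborel)"
proof -
  have "(\<integral>\<^sup>+x\<in>A. (\<integral>\<^sup>+y\<in>B. k (x - y) \<partial>lborel) \<partial>lborel) =
    (\<integral>\<^sup>+x. (\<integral>\<^sup>+z. k z * (indicator A x * indicator B (x - z)) \<partial>lborel) \<partial>lborel)"
  proof (rule nn_integral_cong)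
    fix x :: 'a
    have "(\<integral>\<^sup>+y\<in>B. k (x - y) \<partial>lborel) = (\<integral>\<^sup>+z. k z * indicator B (x - z) \<partial>lborel)"
      using nn_integral_lborel_reflect[of "\<lambda>y. k (x - y) * indicator B y" x] by simp
    then show "(\<integral>\<^sup>+y\<in>B. k (x - y) \<partial>lborel) * indicator A x =
        (\<integral>\<^sup>+z. k z * (indicator A x * indicator B (x - z)) \<partial>lborel)"
      by (cases "x \<in> A") simp_all
  qed
  also have "\<dots> = (\<integral>\<^sup>+z. (\<integral>\<^sup>+x. k z * (indicator A x * indicator B (x - z)) \<partial>lborel) \<partial>lborel)"
    by (rule lborel_pair.Fubini') measurable
  also have "\<dots> = (\<integral>\<^sup>+z. k z * emeasure lborel {x \<in> A. x - z \<in> B} \<partial>lborel)"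
    by (simp add: emeasure_shift_Int_eq nn_integral_cmult)
  finally show ?thesis .
qed

section \<open>Upper and lower bounds for the scaled perimeter\<close>

context symmetric_body
begin

lemma fractional_perimeter_eq:
  assumes [measurable]: "E \<in> sets borel"
  shows "fractional_perimeter \<alpha> E K =
    (\<integral>\<^sup>+z. ennreal (N z powr (- real DIM('a) - \<alpha>)) * emeasure lborel {x \<in> E. x - z \<in> - E} \<partial>lborel)"
  unfolding fractional_perimeter_def
  by (rule nn_integral_interaction_eq[where k = "\<lambda>z. ennreal (N z powr (- real DIM('a) - \<alpha>))"]) auto

text \<open>The constant c collects the contribution of N \<le> 1 and is chosen before \<alpha>, so
  that the error vanishes with \<alpha>.\<close>

lemma fractional_perimeter_upper:
  assumes E [measurable]: "E \<in> sets borel" and fin: "emeasure lborel E < \<infinity>" and per: "finite_perimeter E"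
  obtains c where "0 \<le> c" "\<And>\<alpha>. 0 < \<alpha> \<Longrightarrow> \<alpha> \<le> 1/2 \<Longrightarrow> ennreal \<alpha> * fractional_perimeter \<alpha> E K \<le>
    ennreal (real DIM('a) * measure lborel K * measure lborel E + \<alpha> * c)"
proof -
  define d where "d = real DIM('a)"
  define P where "P = enn2real (dist_variation (dist_gradient (indicator E)) UNIV)"
  obtain R where R: "0 < R" "\<And>x. norm x \<le> R * N x" using norm_le_body_norm by blast
  define b where "b = P * R"
  have b: "0 \<le> b" using R by (simp add: b_def P_def)
  define c where "c = (2 * d + 1) * measure lborel K * b"
  have m: "emeasure lborel E = ennreal (measure lborel E)"
    using fin by (simp add: emeasure_eq_ennreal_measure less_top)
  have c: "0 \<le> c" using b by (simp add: c_def d_def)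
  have "ennreal \<alpha> * fractional_perimeter \<alpha> E K \<le> ennreal (d * measure lborel K * measure lborel E + \<alpha> * c)"
    if \<alpha>: "0 < \<alpha>" "\<alpha> \<le> 1/2" for \<alpha>
  proof -
    let ?S = "{z. 1 < N z}" and ?T = "{z. 0 < N z \<and> N z \<le> 1}"
    have "fractional_perimeter \<alpha> E K \<le>
      (\<integral>\<^sup>+z. ennreal (N z powr (- d - \<alpha>)) * indicator ?S z * ennreal (measure lborel E) +
             ennreal (N z powr (1 - d - \<alpha>)) * indicator ?T z * ennreal b \<partial>lborel)"
      unfolding fractional_perimeter_eq[OF E] d_def[symmetric]
    proof (rule nn_integral_mono)
      fix z :: 'a
      let ?g = "emeasure lborel {x \<in> E. x - z \<in> - E}"
      \<comment> \<open>At the origin the convention \<open>0 powr a = 0\<close> makes the left side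
        vanish.\<close>
      consider "N z = 0" | "z \<in> ?S" | "z \<in> ?T" using body_norm_nonneg[of z] by force
      then show "ennreal (N z powr (- d - \<alpha>)) * ?g \<le>
          ennreal (N z powr (- d - \<alpha>)) * indicator ?S z * ennreal (measure lborel E) +
          ennreal (N z powr (1 - d - \<alpha>)) * indicator ?T z * ennreal b"
      proof cases
        case 2
        have "?g \<le> ennreal (measure lborel E)"
          unfolding m[symmetric] by (rule emeasure_mono) auto
        then have "ennreal (N z powr (- d - \<alpha>)) * ?g \<le> ennreal (N z powr (- d - \<alpha>)) * ennreal (measure lborel E)"
          by (rule mult_left_mono) simp
        then show ?thesis using 2 by (simp add: add_increasing2)
      next
        case 3
        have "?g \<le> ennreal (P * norm z)"
          using emeasure_shift_diff_le[OF E fin per, of z] by (simp add: P_def)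
        also have "\<dots> \<le> ennreal (N z * b)"
          using mult_left_mono[OF R(2)[of z], of P] by (intro ennreal_leI) (simp add: P_def b_def mult_ac)
        finally have "ennreal (N z powr (- d - \<alpha>)) * ?g \<le> ennreal (N z powr (- d - \<alpha>)) * ennreal (N z * b)"
          by (rule mult_left_mono) simp
        \<comment> \<open>The linear factor is written as a power so that it merges with the kernel
          and raises its exponent by 1.\<close>
        also have "\<dots> = ennreal (N z powr (- d - \<alpha>) * N z powr 1 * b)"
          using 3 b by (simp add: ennreal_mult' mult.assoc)
        also have "\<dots> = ennreal (N z powr (1 - d - \<alpha>)) * ennreal b"
          using b by (simp only: powr_add[symmetric] ennreal_mult'') (simp add: algebra_simps)
        finally show ?thesis using 3 by (simp add: add_increasing)
      qed simp
    qed
    also have "\<dots> = (\<integral>\<^sup>+z\<in>?S. ennreal (N z powr (- d - \<alpha>)) \<partial>lborel) * ennreal (measure lborel E) +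
        (\<integral>\<^sup>+z\<in>?T. ennreal (N z powr (1 - d - \<alpha>)) \<partial>lborel) * ennreal b"
      by (subst nn_integral_add) (simp_all add: nn_integral_multc)
    also have "\<dots> \<le> ennreal (d * measure lborel K / \<alpha>) * ennreal (measure lborel E) +
        ennreal ((2 * d + 1) * measure lborel K) * ennreal b"
      using nn_integral_body_norm_outside[OF \<alpha>(1)] nn_integral_body_norm_inside[OF \<alpha>]
      by (intro add_mono mult_right_mono) (simp_all add: d_def)
    also have "\<dots> = ennreal (d * measure lborel K / \<alpha> * measure lborel E + c)"
      using \<alpha> b c by (simp add: c_def d_def flip: ennreal_mult'' ennreal_plus)
    finally have "ennreal \<alpha> * fractional_perimeter \<alpha> E K \<le>
        ennreal \<alpha> * ennreal (d * measure lborel K / \<alpha> * measure lborel E + c)"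
      by (rule mult_left_mono) simp
    also have "\<dots> = ennreal (\<alpha> * (d * measure lborel K / \<alpha> * measure lborel E + c))"
      using \<alpha> by (simp add: ennreal_mult')
    also have "\<alpha> * (d * measure lborel K / \<alpha> * measure lborel E + c) =
        d * measure lborel K * measure lborel E + \<alpha> * c"
      using \<alpha> by (simp add: distrib_left)
    finally show ?thesis .
  qed
  with c show thesis using that unfolding d_def by blast
qed

text \<open>Where N > 1 the kernel is at most 1, so replacing |E - (E + z)| by |E| costs at most |E
  \<inter> (E + z)|, whose integral over all z is |E|^2. The loss is carried as a summand on the
  larger side and subtracted only at the end; a negative difference is truncated to 0 by
  \<open>ennreal\<close>.\<close>

lemma fractional_perimeter_lower:
  assumes E [measurable]: "E \<in> sets borel" and fin: "emeasure lborel E < \<infinity>" and \<alpha>: "0 < \<alpha>"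
  shows "ennreal (real DIM('a) * measure lborel K * measure lborel E - \<alpha> * (measure lborel E)\<^sup>2)
    \<le> ennreal \<alpha> * fractional_perimeter \<alpha> E K"
proof -
  define d where "d = real DIM('a)"
  define m where "m = measure lborel E"
  have m: "emeasure lborel E = ennreal m" "0 \<le> m"
    using fin by (simp_all add: m_def emeasure_eq_ennreal_measure less_top)
  let ?S = "{z. 1 < N z}"
  define g where "g z = emeasure lborel {x \<in> E. x - z \<in> - E}" for z
  define h where "h z = emeasure lborel {x \<in> E. x - z \<in> E}" for z
  have [measurable]: "g \<in> borel_measurable borel" "h \<in> borel_measurable borel"
    unfolding g_def[abs_def] h_def[abs_def] by measurable
  have gh: "ennreal m = g z + h z" for z
  proof -
    have "{x \<in> space borel. x \<in> E \<and> x - z \<in> E} \<in> sets borel"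
      "{x \<in> space borel. x \<in> E \<and> x - z \<in> - E} \<in> sets borel" by measurable
    then have "g z + h z = emeasure lborel ({x \<in> E. x - z \<in> - E} \<union> {x \<in> E. x - z \<in> E})"
      unfolding g_def h_def by (intro plus_emeasure) auto
    also have "{x \<in> E. x - z \<in> - E} \<union> {x \<in> E. x - z \<in> E} = E" by auto
    finally show ?thesis using m by simp
  qed
  \<comment> \<open>The factor 1 is the constant kernel of the interaction formula.\<close>
  have "(\<integral>\<^sup>+z. 1 * h z \<partial>lborel) = (\<integral>\<^sup>+x\<in>E. (\<integral>\<^sup>+y\<in>E. 1 \<partial>lborel) \<partial>lborel)"
    unfolding h_def by (rule nn_integral_interaction_eq[where k = "\<lambda>z. 1", symmetric]) auto
  also have "\<dots> = ennreal (m\<^sup>2)"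
    using m by (simp add: nn_integral_cmult power2_eq_square ennreal_mult')
  finally have h: "(\<integral>\<^sup>+z. h z \<partial>lborel) = ennreal (m\<^sup>2)" by simp
  have "ennreal (d * measure lborel K / \<alpha>) * ennreal m =
      (\<integral>\<^sup>+z. ennreal (N z powr (- d - \<alpha>)) * indicator ?S z * ennreal m \<partial>lborel)"
    using nn_integral_body_norm_outside[OF \<alpha>] by (simp add: nn_integral_multc d_def)
  also have "\<dots> \<le> (\<integral>\<^sup>+z. ennreal (N z powr (- d - \<alpha>)) * g z + h z \<partial>lborel)"
  proof (rule nn_integral_mono)
    fix z :: 'a
    show "ennreal (N z powr (- d - \<alpha>)) * indicator ?S z * ennreal m \<le> ennreal (N z powr (- d - \<alpha>)) * g z + h z"
    proof (cases "1 < N z")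
      case True
      have "N z powr (- d - \<alpha>) \<le> N z powr 0"
        using True \<alpha> by (intro powr_mono) (auto simp: d_def)
      then have "ennreal (N z powr (- d - \<alpha>)) \<le> 1" using True by simp
      then have "ennreal (N z powr (- d - \<alpha>)) * h z \<le> 1 * h z" by (rule mult_right_mono) simp
      then show ?thesis using True by (simp add: gh[of z] distrib_left add_left_mono)
    qed simp
  qed
  also have "\<dots> = fractional_perimeter \<alpha> E K + ennreal (m\<^sup>2)"
    unfolding fractional_perimeter_eq[OF E] d_def g_def[symmetric]
    by (subst nn_integral_add) (simp_all add: h)
  finally have "ennreal \<alpha> * (ennreal (d * measure lborel K / \<alpha>) * ennreal m) \<le>
      ennreal \<alpha> * (fractional_perimeter \<alpha> E K + ennreal (m\<^sup>2))"
    by (rule mult_left_mono) simp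
  moreover have "ennreal \<alpha> * (ennreal (d * measure lborel K / \<alpha>) * ennreal m) = ennreal (d * measure lborel K * m)"
    using \<alpha> m by (simp add: d_def flip: ennreal_mult'')
  moreover have "ennreal \<alpha> * (fractional_perimeter \<alpha> E K + ennreal (m\<^sup>2)) =
      ennreal \<alpha> * fractional_perimeter \<alpha> E K + ennreal (\<alpha> * m\<^sup>2)"
    using \<alpha> by (simp add: distrib_left ennreal_mult')
  ultimately show ?thesis
    using \<alpha> by (simp add: ennreal_minus[symmetric] ennreal_minus_le_iff add.commute d_def m_def flip: ennreal_minus)
qed

end

theorem proposition3p19:
  fixes K E :: "'a::euclidean_space set"
  assumes "origin_symmetric_convex_body K"
    and "E \<in> sets borel"
    and "emeasure lborel E < \<infinity>"
    and "finite_perimeter E"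
  shows "((\<lambda>\<alpha>. ennreal \<alpha> * fractional_perimeter \<alpha> E K) \<longlongrightarrow>
           of_nat DIM('a) * emeasure lborel K * emeasure lborel E) (at_right 0)"
proof -
  interpret symmetric_body K by standard (rule assms)
  let ?L = "real DIM('a) * measure lborel K * measure lborel E"
  obtain c where c: "0 \<le> c" "\<And>\<alpha>. 0 < \<alpha> \<Longrightarrow> \<alpha> \<le> 1/2 \<Longrightarrow>
      ennreal \<alpha> * fractional_perimeter \<alpha> E K \<le> ennreal (?L + \<alpha> * c)"
    using fractional_perimeter_upper[OF assms(2-4)] by blast
  have "emeasure lborel E = ennreal (measure lborel E)"
    using assms(3) by (simp add: emeasure_eq_ennreal_measure less_top)
  \<comment> \<open>All factors are finite, so the limit is a real number and both bounding
    functions can be handled as real limits.\<close>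
  then have L: "of_nat DIM('a) * emeasure lborel K * emeasure lborel E = ennreal ?L"
    by (simp add: emeasure_K ennreal_mult' ennreal_of_nat_eq_real_of_nat)
  have small: "\<forall>\<^sub>F \<alpha> in at_right 0. 0 < \<alpha> \<and> \<alpha> \<le> (1/2 :: real)"
    unfolding eventually_at_right_field by (intro exI[of _ "1/2"]) auto
  show ?thesis
    unfolding L
  proof (rule tendsto_sandwich)
    show "\<forall>\<^sub>F \<alpha> in at_right 0. ennreal (?L - \<alpha> * (measure lborel E)\<^sup>2) \<le> ennreal \<alpha> * fractional_perimeter \<alpha> E K"
      using small by eventually_elim (use fractional_perimeter_lower[OF assms(2,3)] in auto)
    show "\<forall>\<^sub>F \<alpha> in at_right 0. ennreal \<alpha> * fractional_perimeter \<alpha> E K \<le> ennreal (?L + \<alpha> * c)"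
      using small by eventually_elim (use c(2) in auto)
    have "((\<lambda>\<alpha>. ?L - \<alpha> * (measure lborel E)\<^sup>2) \<longlongrightarrow> ?L - 0 * (measure lborel E)\<^sup>2) (at_right 0)"
      by (intro tendsto_intros)
    then show "((\<lambda>\<alpha>. ennreal (?L - \<alpha> * (measure lborel E)\<^sup>2)) \<longlongrightarrow> ennreal ?L) (at_right 0)"
      by (intro tendsto_ennrealI) simp
    have "((\<lambda>\<alpha>. ?L + \<alpha> * c) \<longlongrightarrow> ?L + 0 * c) (at_right 0)"
      by (intro tendsto_intros)
    then show "((\<lambda>\<alpha>. ennreal (?L + \<alpha> * c)) \<longlongrightarrow> ennreal ?L) (at_right 0)"
      by (intro tendsto_ennrealI) simp
  qed
qed

end
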